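(* Let $\Gamma$ be a compact abelian group (written multiplicatively), and suppose that $\varphi_n(s)=s^n$ for $n\in \mathbb{N}^*$ defines an action of $\mathbb{N}^*$ by surjective endomorphisms of $\Gamma$ with finite kernel. Then $\beta_n(f)(s)=f(\varphi_n(s))$ implements an action $\beta$ of $\mathbb{N}^*$ by (unital) injective endomorphisms of $C(\Gamma)$, and $$L_n(f)(t)=\frac 1{|\{s\in\Gamma\mid \varphi_n(s)=t \}|}\sum_{\{s\in \Gamma\mid \varphi_n(s)=t\}}f(s)$$ for $n\in \mathbb{N}^*$, $f\in C(\Gamma)$, $t\in\Gamma$, is an action of $\mathbb{N}^*$ by transfer operators for $\beta$.
   Context: $\mathbb{N}^*$ is the multiplicative semigroup of non-zero positive integers. A transfer operator for an endomorphism $\beta_n$ of a unital $C^*$-algebra $A$ is a continuous linear positive map $L_n:A\to A$ with $L_n(\beta_n(a)b)=aL_n(b)$ for all $a,b\in A$. An action $L$ by transfer operators for $\beta$ consists of transfer operators $L_n$ for $\beta_n$ with $L_m\circ L_n=L_{mn}$ for all $m,n\in\mathbb{N}^*$ and $L_1=\operatorname{id}$. *)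

theory Defs
  imports "HOL-Analysis.Analysis" "HOL-Algebra.Coset" "HOL-Algebra.Module"
begin

section \<open>Unital C*-algebras\<close>

definition complex_scalars :: "complex ring" where
  "complex_scalars = \<lparr>carrier = UNIV, mult = (*), one = 1, zero = 0, add = (+)\<rparr>"

lemma complex_scalars_simps [simp]:
  "carrier complex_scalars = UNIV"
  "mult complex_scalars = (*)"
  "one complex_scalars = 1"
  "zero complex_scalars = 0"
  "add complex_scalars = (+)"
  by (simp_all add: complex_scalars_def)

lemma cring_complex_scalars: "cring complex_scalars"
proof (intro cringI abelian_groupI comm_monoidI)
  fix x :: complex
  show "\<exists>y\<in>carrier complex_scalars. y \<oplus>\<^bsub>complex_scalars\<^esub> x = \<zero>\<^bsub>complex_scalars\<^esub>"
    by (rule bexI[of _ "- x"]) simp_all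
qed (simp_all add: algebra_simps)

record 'a cstar_alg = "(complex, 'a) module" +
  adj :: "'a \<Rightarrow> 'a"
  cnorm :: "'a \<Rightarrow> real"

text \<open>
  The value 0 outside the carrier is needed because \<^locale>\<open>Metric_space\<close> requires
  nonnegativity and symmetry of its distance function on the whole type.
\<close>

definition cdist :: "('a, 'b) cstar_alg_scheme \<Rightarrow> 'a \<Rightarrow> 'a \<Rightarrow> real" where
  "cdist A x y = (if x \<in> carrier A \<and> y \<in> carrier A then cnorm A (x \<ominus>\<^bsub>A\<^esub> y) else 0)"

locale unital_cstar_algebra = module complex_scalars A + ring A
  for A :: "('a, 'b) cstar_alg_scheme" (structure) +
  assumes smult_mult_left:
      "\<lbrakk>x \<in> carrier A; y \<in> carrier A\<rbrakk> \<Longrightarrow> (c \<odot> x) \<otimes> y = c \<odot> (x \<otimes> y)"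
    and smult_mult_right:
      "\<lbrakk>x \<in> carrier A; y \<in> carrier A\<rbrakk> \<Longrightarrow> x \<otimes> (c \<odot> y) = c \<odot> (x \<otimes> y)"
    and cnorm_nonneg: "x \<in> carrier A \<Longrightarrow> 0 \<le> cnorm A x"
    and cnorm_eq_0: "x \<in> carrier A \<Longrightarrow> cnorm A x = 0 \<longleftrightarrow> x = \<zero>"
    and cnorm_add: "\<lbrakk>x \<in> carrier A; y \<in> carrier A\<rbrakk> \<Longrightarrow> cnorm A (x \<oplus> y) \<le> cnorm A x + cnorm A y"
    and cnorm_smult: "x \<in> carrier A \<Longrightarrow> cnorm A (c \<odot> x) = cmod c * cnorm A x"
    and cnorm_mult: "\<lbrakk>x \<in> carrier A; y \<in> carrier A\<rbrakk> \<Longrightarrow> cnorm A (x \<otimes> y) \<le> cnorm A x * cnorm A y"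
    and complete: "Metric_space.mcomplete (carrier A) (cdist A)"
    and adj_closed: "x \<in> carrier A \<Longrightarrow> adj A x \<in> carrier A"
    and adj_adj: "x \<in> carrier A \<Longrightarrow> adj A (adj A x) = x"
    and adj_add: "\<lbrakk>x \<in> carrier A; y \<in> carrier A\<rbrakk> \<Longrightarrow> adj A (x \<oplus> y) = adj A x \<oplus> adj A y"
    and adj_smult: "x \<in> carrier A \<Longrightarrow> adj A (c \<odot> x) = cnj c \<odot> adj A x"
    and adj_mult: "\<lbrakk>x \<in> carrier A; y \<in> carrier A\<rbrakk> \<Longrightarrow> adj A (x \<otimes> y) = adj A y \<otimes> adj A x"
    and cstar_identity: "x \<in> carrier A \<Longrightarrow> cnorm A (adj A x \<otimes> x) = (cnorm A x)\<^sup>2"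

definition positive_elements :: "('a, 'b) cstar_alg_scheme \<Rightarrow> 'a set" where
  "positive_elements A = {adj A b \<otimes>\<^bsub>A\<^esub> b | b. b \<in> carrier A}"

text \<open>Endomorphisms are *-endomorphisms, not required to be unital.\<close>

locale cstar_endomorphism = unital_cstar_algebra A
  for A :: "('a, 'b) cstar_alg_scheme" (structure) and \<beta> :: "'a \<Rightarrow> 'a" +
  assumes endo_closed: "\<beta> \<in> carrier A \<rightarrow> carrier A"
    and endo_add: "\<lbrakk>a \<in> carrier A; b \<in> carrier A\<rbrakk> \<Longrightarrow> \<beta> (a \<oplus> b) = \<beta> a \<oplus> \<beta> b"
    and endo_smult: "a \<in> carrier A \<Longrightarrow> \<beta> (c \<odot> a) = c \<odot> \<beta> a"
    and endo_mult: "\<lbrakk>a \<in> carrier A; b \<in> carrier A\<rbrakk> \<Longrightarrow> \<beta> (a \<otimes> b) = \<beta> a \<otimes> \<beta> b"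
    and endo_adj: "a \<in> carrier A \<Longrightarrow> \<beta> (adj A a) = adj A (\<beta> a)"

locale transfer_operator = cstar_endomorphism A \<beta>
  for A :: "('a, 'b) cstar_alg_scheme" (structure) and \<beta> :: "'a \<Rightarrow> 'a" and L :: "'a \<Rightarrow> 'a" +
  assumes transfer_closed: "L \<in> carrier A \<rightarrow> carrier A"
    and transfer_continuous:
      "continuous_map (Metric_space.mtopology (carrier A) (cdist A))
         (Metric_space.mtopology (carrier A) (cdist A)) L"
    and transfer_add: "\<lbrakk>a \<in> carrier A; b \<in> carrier A\<rbrakk> \<Longrightarrow> L (a \<oplus> b) = L a \<oplus> L b"
    and transfer_smult: "a \<in> carrier A \<Longrightarrow> L (c \<odot> a) = c \<odot> L a"
    and transfer_positive: "a \<in> positive_elements A \<Longrightarrow> L a \<in> positive_elements A"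
    and transfer_identity: "\<lbrakk>a \<in> carrier A; b \<in> carrier A\<rbrakk> \<Longrightarrow> L (\<beta> a \<otimes> b) = a \<otimes> L b"


section \<open>Actions of the multiplicative semigroup of positive integers\<close>

text \<open>The family is indexed by all of \<^typ>\<open>nat\<close>, but its value at 0 is irrelevant.\<close>

definition Nstar_action :: "'a set \<Rightarrow> (nat \<Rightarrow> 'a \<Rightarrow> 'a) \<Rightarrow> bool" where
  "Nstar_action X \<alpha> \<longleftrightarrow>
     (\<forall>n>0. \<alpha> n \<in> X \<rightarrow> X) \<and>
     (\<forall>x\<in>X. \<alpha> 1 x = x) \<and>
     (\<forall>m>0. \<forall>n>0. \<forall>x\<in>X. \<alpha> m (\<alpha> n x) = \<alpha> (m * n) x)"

definition transfer_action ::
    "('a, 'b) cstar_alg_scheme \<Rightarrow> (nat \<Rightarrow> 'a \<Rightarrow> 'a) \<Rightarrow> (nat \<Rightarrow> 'a \<Rightarrow> 'a) \<Rightarrow> bool" where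
  "transfer_action A \<beta> L \<longleftrightarrow>
     (\<forall>n>0. transfer_operator A (\<beta> n) (L n)) \<and> Nstar_action (carrier A) L"


section \<open>Compact abelian groups\<close>

locale compact_abelian_group = comm_group G
  for G :: "('g, 'm) monoid_scheme" (structure) and T :: "'g topology" +
  assumes topspace_eq: "topspace T = carrier G"
    and continuous_mult: "continuous_map (prod_topology T T) T (\<lambda>(x, y). x \<otimes> y)"
    and continuous_inv: "continuous_map T T (\<lambda>x. inv x)"
    and compact: "compact_space T"
    and Hausdorff: "Hausdorff_space T"

definition surjective_endomorphism_finite_kernel ::
    "('g, 'm) monoid_scheme \<Rightarrow> 'g topology \<Rightarrow> ('g \<Rightarrow> 'g) \<Rightarrow> bool" where
  "surjective_endomorphism_finite_kernel G T \<phi> \<longleftrightarrow>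
     \<phi> \<in> hom G G \<and> continuous_map T T \<phi> \<and> \<phi> ` carrier G = carrier G \<and> finite (kernel G G \<phi>)"

definition power_map :: "('g, 'm) monoid_scheme \<Rightarrow> nat \<Rightarrow> 'g \<Rightarrow> 'g" where
  "power_map G n s = s [^]\<^bsub>G\<^esub> n"


section \<open>The C*-algebra of continuous functions on a compact space\<close>

text \<open>
  Functions are taken to be \<^const>\<open>undefined\<close> outside the space, so that equality in the
  carrier is equality on the space. The supremum norm is meaningful for nonempty compact spaces.
\<close>

definition continuous_functions :: "'g topology \<Rightarrow> ('g \<Rightarrow> complex) cstar_alg" where
  "continuous_functions T =
     \<lparr>carrier = {f \<in> extensional (topspace T). continuous_map T euclidean f},
      mult = (\<lambda>f g. \<lambda>s\<in>topspace T. f s * g s),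
      one = (\<lambda>s\<in>topspace T. 1),
      zero = (\<lambda>s\<in>topspace T. 0),
      add = (\<lambda>f g. \<lambda>s\<in>topspace T. f s + g s),
      smult = (\<lambda>c f. \<lambda>s\<in>topspace T. c * f s),
      adj = (\<lambda>f. \<lambda>s\<in>topspace T. cnj (f s)),
      cnorm = (\<lambda>f. SUP s\<in>topspace T. cmod (f s))\<rparr>"

definition power_pullback ::
    "('g, 'm) monoid_scheme \<Rightarrow> nat \<Rightarrow> ('g \<Rightarrow> complex) \<Rightarrow> ('g \<Rightarrow> complex)" where
  "power_pullback G n f = (\<lambda>s\<in>carrier G. f (power_map G n s))"

definition power_average ::
    "('g, 'm) monoid_scheme \<Rightarrow> nat \<Rightarrow> ('g \<Rightarrow> complex) \<Rightarrow> ('g \<Rightarrow> complex)" where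
  "power_average G n f =
     (\<lambda>t\<in>carrier G. 1 / of_nat (card {s \<in> carrier G. power_map G n s = t}) *
        (\<Sum>s\<in>{s \<in> carrier G. power_map G n s = t}. f s))"

end

theory Submission
  imports Defs
begin

text \<open>
  Pulling back along the power map \<open>\<phi>\<^sub>n\<close> is injective because \<open>\<phi>\<^sub>n\<close> is onto, and it acts pointwise,
  so it is a unital *-endomorphism of \<open>C(\<Gamma>)\<close>. The functions \<open>\<phi>\<^sub>n\<close> commute with one another, so the
  order reversal in the composition of pullbacks does no harm.

  The averages \<open>L\<^sub>n f\<close> raise three questions.

  \<^item> Is \<open>L\<^sub>n f\<close> continuous? The fibre of \<open>\<phi>\<^sub>n\<close> through \<open>s\<close> is the coset \<open>K s\<close> of the finite
    kernel \<open>K\<close>, so \<open>L\<^sub>n f (\<phi>\<^sub>n s)\<close> is the mean of \<open>f (k s)\<close> over \<open>k \<in> K\<close>, a finite sum of continuous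
    functions of \<open>s\<close>. A continuous map from a compact space onto a Hausdorff space is a quotient
    map, so continuity of \<open>L\<^sub>n f \<circ> \<phi>\<^sub>n\<close> gives continuity of \<open>L\<^sub>n f\<close>.
    This is \<open>fibre_average_closed\<close>.
  \<^item> Is \<open>L\<^sub>n\<close> a transfer operator? A mean of numbers bounded by \<open>B\<close> is bounded by \<open>B\<close>, so \<open>L\<^sub>n\<close>
    contracts the supremum norm; a mean of nonnegative numbers is nonnegative; and \<open>a \<circ> \<phi>\<^sub>n\<close> is
    constant on each fibre, so it comes out of the mean. This is \<open>transfer_operator_fibre_average\<close>,
    which holds for any continuous self-map of a nonempty compact space whose averages preserve
    continuity.
  \<^item> Does \<open>L\<^sub>m L\<^sub>n = L\<^sub>m\<^sub>n\<close> hold? A fibre of \<open>\<phi>\<^sub>m \<circ> \<phi>\<^sub>n\<close> is the disjoint union of fibres of \<open>\<phi>\<^sub>n\<close>. These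
    all have the same size, being cosets of one kernel, so the mean of the means is the mean over
    the union. This is \<open>fibre_average_fibre_average\<close>.
\<close>

section \<open>Continuous functions on a compact space form a unital C*-algebra\<close>

lemma continuous_functions_simps [simp]:
  "mult (continuous_functions T) = (\<lambda>f g. \<lambda>s\<in>topspace T. f s * g s)"
  "one (continuous_functions T) = (\<lambda>s\<in>topspace T. 1)"
  "zero (continuous_functions T) = (\<lambda>s\<in>topspace T. 0)"
  "add (continuous_functions T) = (\<lambda>f g. \<lambda>s\<in>topspace T. f s + g s)"
  "smult (continuous_functions T) = (\<lambda>c f. \<lambda>s\<in>topspace T. c * f s)"
  "adj (continuous_functions T) = (\<lambda>f. \<lambda>s\<in>topspace T. cnj (f s))"
  by (simp_all add: continuous_functions_def)

lemma in_continuous_functions_iff: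
  "f \<in> carrier (continuous_functions T) \<longleftrightarrow>
     f \<in> extensional (topspace T) \<and> continuous_map T euclidean f"
  by (simp add: continuous_functions_def)

lemma restrict_in_continuous_functions_iff:
  "restrict f (topspace T) \<in> carrier (continuous_functions T) \<longleftrightarrow> continuous_map T euclidean f"
  by (auto simp: in_continuous_functions_iff elim: continuous_map_eq)

lemma continuous_functions_continuous:
  "f \<in> carrier (continuous_functions T) \<Longrightarrow> continuous_map T euclidean f"
  by (simp add: in_continuous_functions_iff)

lemma continuous_functions_extensional:
  "f \<in> carrier (continuous_functions T) \<Longrightarrow> f \<in> extensional (topspace T)"
  by (simp add: in_continuous_functions_iff)

lemma continuous_map_complex_mult [continuous_intros]:
  fixes f g :: "'a \<Rightarrow> complex"
  assumes "continuous_map T euclidean f" "continuous_map T euclidean g"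
  shows "continuous_map T euclidean (\<lambda>s. f s * g s)"
  using assms by (simp add: continuous_map_atin tendsto_mult)

lemma continuous_map_cnj [continuous_intros]:
  assumes "continuous_map T euclidean f"
  shows "continuous_map T euclidean (\<lambda>s. cnj (f s))"
  using assms by (simp add: continuous_map_atin tendsto_cnj)

lemma const_in_continuous_functions [simp]:
  "(\<lambda>s\<in>topspace T. c) \<in> carrier (continuous_functions T)"
  by (simp add: restrict_in_continuous_functions_iff)

lemma continuous_functions_closed [simp]:
  assumes "f \<in> carrier (continuous_functions T)"
  shows "(\<lambda>s\<in>topspace T. c * f s) \<in> carrier (continuous_functions T)"
    and "(\<lambda>s\<in>topspace T. - f s) \<in> carrier (continuous_functions T)"
    and "(\<lambda>s\<in>topspace T. cnj (f s)) \<in> carrier (continuous_functions T)"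
    and "g \<in> carrier (continuous_functions T) \<Longrightarrow>
      (\<lambda>s\<in>topspace T. f s + g s) \<in> carrier (continuous_functions T)"
    and "g \<in> carrier (continuous_functions T) \<Longrightarrow>
      (\<lambda>s\<in>topspace T. f s - g s) \<in> carrier (continuous_functions T)"
    and "g \<in> carrier (continuous_functions T) \<Longrightarrow>
      (\<lambda>s\<in>topspace T. f s * g s) \<in> carrier (continuous_functions T)"
  using assms
  by (simp_all add: restrict_in_continuous_functions_iff continuous_functions_continuous
      continuous_map_add continuous_map_diff continuous_map_complex_mult continuous_map_cnj)

text \<open>
  The simplifier flattens the nested restrictions in the product of \<open>f\<close> with its adjoint to this
  form. The closure rule for products does not apply to it directly, since the unrestricted
  conjugate of \<open>f\<close> need not lie in the carrier.
\<close>

lemma cnj_mult_self_closed: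
  assumes "f \<in> carrier (continuous_functions T)"
  shows "(\<lambda>s\<in>topspace T. cnj (f s) * f s) \<in> carrier (continuous_functions T)"
  using continuous_functions_closed(6)[OF continuous_functions_closed(3)[OF assms] assms]
  by (simp cong: restrict_cong)

lemma abelian_group_continuous_functions: "abelian_group (continuous_functions T)"
proof (rule abelian_groupI)
  fix f assume f: "f \<in> carrier (continuous_functions T)"
  show "\<exists>g\<in>carrier (continuous_functions T).
          g \<oplus>\<^bsub>continuous_functions T\<^esub> f = \<zero>\<^bsub>continuous_functions T\<^esub>"
    using f by (intro bexI[of _ "\<lambda>s\<in>topspace T. - f s"]) (auto intro!: restrict_ext)
qed (auto intro!: restrict_ext
     intro: extensionalityI[OF _ continuous_functions_extensional] simp: add_ac)

lemma ring_continuous_functions: "ring (continuous_functions T)"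
proof (rule ringI)
  show "monoid (continuous_functions T)"
    by (rule monoidI)
      (auto intro!: restrict_ext
        intro: extensionalityI[OF _ continuous_functions_extensional] simp: mult_ac)
qed (auto intro!: abelian_group_continuous_functions restrict_ext simp: algebra_simps)

lemma module_continuous_functions: "module complex_scalars (continuous_functions T)"
  by (rule moduleI[OF cring_complex_scalars abelian_group_continuous_functions])
    (auto intro!: restrict_ext
      intro: extensionalityI[OF _ continuous_functions_extensional] simp: algebra_simps)

lemma continuous_functions_minus:
  assumes f: "f \<in> carrier (continuous_functions T)" and g: "g \<in> carrier (continuous_functions T)"
  shows "f \<ominus>\<^bsub>continuous_functions T\<^esub> g = (\<lambda>s\<in>topspace T. f s - g s)"
proof -
  interpret abelian_group "continuous_functions T"
    by (rule abelian_group_continuous_functions)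
  have "\<ominus>\<^bsub>continuous_functions T\<^esub> g = (\<lambda>s\<in>topspace T. - g s)"
    using g by (intro minus_equality) (auto intro!: restrict_ext)
  then show ?thesis
    by (auto simp: a_minus_def intro!: restrict_ext)
qed

lemma bdd_above_cmod_continuous_functions:
  assumes "compact_space T" and f: "f \<in> carrier (continuous_functions T)"
  shows "bdd_above ((\<lambda>s. cmod (f s)) ` topspace T)"
proof -
  have "compactin euclideanreal ((\<lambda>s. cmod (f s)) ` topspace T)"
    using assms by (intro image_compactin continuous_map_norm)
      (auto simp: compact_space_def continuous_functions_continuous)
  then show ?thesis
    by (auto intro: compact_imp_bounded bounded_imp_bdd_above)
qed

lemma cmod_le_cnorm:
  assumes "compact_space T" "f \<in> carrier (continuous_functions T)" "s \<in> topspace T"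
  shows "cmod (f s) \<le> cnorm (continuous_functions T) f"
  using bdd_above_cmod_continuous_functions[OF assms(1,2)] assms(3)
  by (auto simp: continuous_functions_def intro!: cSUP_upper)

lemma cnorm_le:
  assumes "topspace T \<noteq> {}" and "\<And>s. s \<in> topspace T \<Longrightarrow> cmod (f s) \<le> B"
  shows "cnorm (continuous_functions T) f \<le> B"
  using assms by (auto simp: continuous_functions_def intro!: cSUP_least)

text \<open>
  The metric facts about \<open>C(T)\<close>, in particular completeness, come from the space of bounded
  continuous functions into the complete space of complex numbers: on a compact space every
  continuous function is bounded. The two distance functions agree only on the carrier, because
  they take their default value 0 on different sets of pairs. So the two metric
  spaces are not equal as terms, and their axioms and limits are matched separately.
\<close>

lemma carrier_continuous_functions_eq_mspace:
  "compact_space T \<Longrightarrow> carrier (continuous_functions T) = mspace (cfunspace T euclidean_metric)"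
  by (subst compactin_mspace_cfunspace)
    (auto simp: in_continuous_functions_iff compact_space_def)

lemma cdist_eq_mdist_cfunspace:
  assumes T: "compact_space T" "topspace T \<noteq> {}"
    and f: "f \<in> carrier (continuous_functions T)" and g: "g \<in> carrier (continuous_functions T)"
  shows "cdist (continuous_functions T) f g = mdist (cfunspace T euclidean_metric) f g"
proof -
  have le: "mdist (cfunspace T euclidean_metric) f g \<le> a \<longleftrightarrow>
      (\<forall>s\<in>topspace T. cmod (f s - g s) \<le> a)" for a
    using f g T by (subst cfunspace_mdist_le)
      (auto simp: dist_norm carrier_continuous_functions_eq_mspace)
  have diff: "(\<lambda>s\<in>topspace T. f s - g s) \<in> carrier (continuous_functions T)"
    using f g by (rule continuous_functions_closed)
  have "cdist (continuous_functions T) f g \<le> a \<longleftrightarrow> (\<forall>s\<in>topspace T. cmod (f s - g s) \<le> a)" for a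
  proof -
    have "cdist (continuous_functions T) f g
        = cnorm (continuous_functions T) (\<lambda>s\<in>topspace T. f s - g s)"
      using f g by (simp add: cdist_def continuous_functions_minus)
    then show ?thesis
      using cmod_le_cnorm[OF T(1) diff]
      by (auto intro!: cnorm_le[OF T(2)] intro: order_trans)
  qed
  with le show ?thesis
    by (metis order_antisym order_refl)
qed

lemma Metric_space_cdist:
  assumes T: "compact_space T" "topspace T \<noteq> {}"
  shows "Metric_space (carrier (continuous_functions T)) (cdist (continuous_functions T))"
proof -
  let ?A = "continuous_functions T" and ?m = "cfunspace T (euclidean_metric :: complex metric)"
  note eq = cdist_eq_mdist_cfunspace[OF T] and C = carrier_continuous_functions_eq_mspace[OF T(1)]
  have sym_nonneg: "cdist ?A f g = cdist ?A g f \<and> 0 \<le> cdist ?A f g" for f g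
    using eq[of f g] eq[of g f] by (cases "f \<in> carrier ?A \<and> g \<in> carrier ?A") 
      (auto simp: mdist_commute, auto simp: cdist_def)
  show ?thesis
  proof
    show "cdist ?A f g = 0 \<longleftrightarrow> f = g" if "f \<in> carrier ?A" "g \<in> carrier ?A" for f g
      using that eq[of f g] C Metric_space.zero[OF Metric_space_mspace_mdist[of ?m]] by metis
    show "cdist ?A f h \<le> cdist ?A f g + cdist ?A g h"
      if "f \<in> carrier ?A" "g \<in> carrier ?A" "h \<in> carrier ?A" for f g h
      using that eq C Metric_space.triangle[OF Metric_space_mspace_mdist[of ?m]] by metis
  qed (use sym_nonneg in blast)+
qed

lemma mcomplete_continuous_functions:
  assumes T: "compact_space T" "topspace T \<noteq> {}"
  shows "Metric_space.mcomplete (carrier (continuous_functions T)) (cdist (continuous_functions T))"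
proof -
  let ?A = "continuous_functions T" and ?m = "cfunspace T (euclidean_metric :: complex metric)"
  note eq = cdist_eq_mdist_cfunspace[OF T] and C = carrier_continuous_functions_eq_mspace[OF T(1)]
  interpret A: Metric_space "carrier ?A" "cdist ?A" by (rule Metric_space_cdist[OF T])
  interpret M: Metric_space "carrier ?A" "mdist ?m"
    unfolding C by (rule Metric_space_mspace_mdist)
  have M: "M.mcomplete"
    unfolding C using Met_TC.mcomplete_cfunspace[of T] complete_UNIV
    by (simp add: mcomplete_of_def Met_TC.Self_def flip: euclidean_metric_def)
  show ?thesis
    unfolding A.mcomplete_def
  proof (intro allI impI)
    fix \<sigma> assume "A.MCauchy \<sigma>"
    then have \<sigma>: "range \<sigma> \<subseteq> carrier ?A" and "M.MCauchy \<sigma>"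
      using eq by (auto simp: A.MCauchy_def M.MCauchy_def image_subset_iff)
    then obtain g where "limitin M.mtopology \<sigma> g sequentially"
      using M by (auto simp: M.mcomplete_def)
    then have "limitin A.mtopology \<sigma> g sequentially"
      using eq \<sigma>
      by (auto simp: A.limit_metric_sequentially M.limit_metric_sequentially image_subset_iff)
    then show "\<exists>g. limitin A.mtopology \<sigma> g sequentially" by blast
  qed
qed

theorem unital_cstar_algebra_continuous_functions:
  assumes T: "compact_space T" "topspace T \<noteq> {}"
  shows "unital_cstar_algebra (continuous_functions T)"
proof -
  let ?A = "continuous_functions T"
  note norm_le = cnorm_le[OF T(2)] and le_norm = cmod_le_cnorm[OF T(1)]
  have nonneg: "0 \<le> cnorm ?A f" if "f \<in> carrier ?A" for f
    using T(2) le_norm[OF that] norm_ge_zero order_trans by (metis ex_in_conv)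
  show ?thesis
  proof (intro unital_cstar_algebra.intro unital_cstar_algebra_axioms.intro
      module_continuous_functions ring_continuous_functions mcomplete_continuous_functions T)
    fix f assume f: "f \<in> carrier ?A"
    show "0 \<le> cnorm ?A f" by (rule nonneg[OF f])
    show "cnorm ?A f = 0 \<longleftrightarrow> f = \<zero>\<^bsub>?A\<^esub>"
    proof
      assume "cnorm ?A f = 0"
      then show "f = \<zero>\<^bsub>?A\<^esub>"
        using le_norm[OF f] by (intro extensionalityI[OF continuous_functions_extensional[OF f]]) auto
    next
      assume "f = \<zero>\<^bsub>?A\<^esub>"
      then show "cnorm ?A f = 0"
        using nonneg[OF f] by (intro order_antisym norm_le) auto
    qed
    show "adj ?A f \<in> carrier ?A"
      using f by simp
    show "adj ?A (adj ?A f) = f"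
      using f by (intro extensionalityI[OF _ continuous_functions_extensional]) auto
    show "cnorm ?A (adj ?A f \<otimes>\<^bsub>?A\<^esub> f) = (cnorm ?A f)\<^sup>2"
    proof (rule order_antisym)
      have "cmod (f s) * cmod (f s) \<le> (cnorm ?A f)\<^sup>2" if "s \<in> topspace T" for s
        using le_norm[OF f that] nonneg[OF f] by (simp add: power2_eq_square mult_mono)
      then show "cnorm ?A (adj ?A f \<otimes>\<^bsub>?A\<^esub> f) \<le> (cnorm ?A f)\<^sup>2"
        by (intro norm_le) (simp add: norm_mult)
      have h: "adj ?A f \<otimes>\<^bsub>?A\<^esub> f \<in> carrier ?A"
        using f by (simp add: cnj_mult_self_closed cong: restrict_cong)
      \<comment> \<open>The bounds on suprema are linear, so the square moves to the other side as a root.\<close>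
      have "cnorm ?A f \<le> sqrt (cnorm ?A (adj ?A f \<otimes>\<^bsub>?A\<^esub> f))"
      proof (rule norm_le)
        fix s assume "s \<in> topspace T"
        then have "(cmod (f s))\<^sup>2 \<le> cnorm ?A (adj ?A f \<otimes>\<^bsub>?A\<^esub> f)"
          using le_norm[OF h] by (simp add: norm_mult power2_eq_square)
        then show "cmod (f s) \<le> sqrt (cnorm ?A (adj ?A f \<otimes>\<^bsub>?A\<^esub> f))"
          by (rule real_le_rsqrt)
      qed
      then show "(cnorm ?A f)\<^sup>2 \<le> cnorm ?A (adj ?A f \<otimes>\<^bsub>?A\<^esub> f)"
        using nonneg[OF f] nonneg[OF h] power_mono real_sqrt_pow2 by metis
    qed
    fix c
    show "adj ?A (c \<odot>\<^bsub>?A\<^esub> f) = cnj c \<odot>\<^bsub>?A\<^esub> adj ?A f"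
      by (auto intro!: restrict_ext)
    show "cnorm ?A (c \<odot>\<^bsub>?A\<^esub> f) = cmod c * cnorm ?A f"
    proof (rule order_antisym)
      show "cnorm ?A (c \<odot>\<^bsub>?A\<^esub> f) \<le> cmod c * cnorm ?A f"
        using le_norm[OF f] by (intro norm_le) (simp add: norm_mult mult_left_mono)
      show "cmod c * cnorm ?A f \<le> cnorm ?A (c \<odot>\<^bsub>?A\<^esub> f)"
      proof (cases "c = 0")
        case True
        then show ?thesis
          using f by (auto intro!: nonneg)
      next
        case False
        have cf: "c \<odot>\<^bsub>?A\<^esub> f \<in> carrier ?A"
          using f by simp
        have "cnorm ?A f \<le> cnorm ?A (c \<odot>\<^bsub>?A\<^esub> f) / cmod c"
          using le_norm[OF cf] False
          by (intro norm_le) (simp add: norm_mult pos_le_divide_eq mult.commute)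
        then show ?thesis
          using False by (simp add: pos_le_divide_eq mult.commute)
      qed
    qed
    fix g assume g: "g \<in> carrier ?A"
    show "cnorm ?A (f \<oplus>\<^bsub>?A\<^esub> g) \<le> cnorm ?A f + cnorm ?A g"
      using le_norm[OF f] le_norm[OF g]
      by (intro norm_le) (auto intro!: norm_triangle_mono)
    show "cnorm ?A (f \<otimes>\<^bsub>?A\<^esub> g) \<le> cnorm ?A f * cnorm ?A g"
      using le_norm[OF f] le_norm[OF g] nonneg[OF f]
      by (intro norm_le) (auto simp: norm_mult intro!: mult_mono)
  qed (auto intro!: restrict_ext)
qed

text \<open>
  The pointwise square root of a nonnegative continuous function is continuous, real, and hence
  its own adjoint.
\<close>

lemma positive_elements_continuous_functions_iff:
  "f \<in> positive_elements (continuous_functions T) \<longleftrightarrow>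
     f \<in> carrier (continuous_functions T) \<and> (\<forall>s\<in>topspace T. f s \<in> \<real>\<^sub>\<ge>\<^sub>0)"
proof
  assume "f \<in> positive_elements (continuous_functions T)"
  then obtain b where b: "b \<in> carrier (continuous_functions T)"
    and f: "f = adj (continuous_functions T) b \<otimes>\<^bsub>continuous_functions T\<^esub> b"
    by (auto simp: positive_elements_def)
  have "cnj (b s) * b s \<in> \<real>\<^sub>\<ge>\<^sub>0" for s
    by (simp add: complex_nonneg_Reals_iff)
  with b f show "f \<in> carrier (continuous_functions T) \<and> (\<forall>s\<in>topspace T. f s \<in> \<real>\<^sub>\<ge>\<^sub>0)"
    by (simp add: cnj_mult_self_closed cong: restrict_cong)
next
  assume f: "f \<in> carrier (continuous_functions T) \<and> (\<forall>s\<in>topspace T. f s \<in> \<real>\<^sub>\<ge>\<^sub>0)"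
  let ?b = "\<lambda>s\<in>topspace T. of_real (sqrt (Re (f s))) :: complex"
  have "continuous_map euclidean euclidean (\<lambda>z. of_real (sqrt (Re z)) :: complex)"
    by (simp add: continuous_intros)
  then have "continuous_map T euclidean ((\<lambda>z. of_real (sqrt (Re z)) :: complex) \<circ> f)"
    using f continuous_map_compose continuous_functions_continuous by blast
  then have b: "?b \<in> carrier (continuous_functions T)"
    by (simp add: restrict_in_continuous_functions_iff comp_def)
  moreover have "f = adj (continuous_functions T) ?b \<otimes>\<^bsub>continuous_functions T\<^esub> ?b"
    using f by (intro extensionalityI[OF continuous_functions_extensional])
      (auto simp: complex_nonneg_Reals_iff complex_eq_iff)
  ultimately show "f \<in> positive_elements (continuous_functions T)"
    unfolding positive_elements_def by blast
qed

section \<open>Pullback along a continuous map\<close>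

definition pullback :: "'g set \<Rightarrow> ('g \<Rightarrow> 'g) \<Rightarrow> ('g \<Rightarrow> complex) \<Rightarrow> ('g \<Rightarrow> complex)" where
  "pullback X \<phi> f = (\<lambda>s\<in>X. f (\<phi> s))"

lemma pullback_closed:
  assumes \<phi>: "continuous_map T T \<phi>" and f: "f \<in> carrier (continuous_functions T)"
  shows "pullback (topspace T) \<phi> f \<in> carrier (continuous_functions T)"
  using continuous_map_compose[OF \<phi> continuous_functions_continuous[OF f]]
  by (simp add: pullback_def restrict_in_continuous_functions_iff comp_def)

lemma cstar_endomorphism_pullback:
  assumes T: "compact_space T" "topspace T \<noteq> {}" and \<phi>: "continuous_map T T \<phi>"
  shows "cstar_endomorphism (continuous_functions T) (pullback (topspace T) \<phi>)"
proof -
  have "\<phi> s \<in> topspace T" if "s \<in> topspace T" for s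
    using \<phi> that by (auto simp: continuous_map_def)
  then show ?thesis
    by (intro cstar_endomorphism.intro cstar_endomorphism_axioms.intro
        unital_cstar_algebra_continuous_functions T)
      (auto intro!: pullback_closed[OF \<phi>] simp: pullback_def)
qed

lemma inj_on_pullback:
  assumes \<phi>: "\<phi> ` topspace T = topspace T"
  shows "inj_on (pullback (topspace T) \<phi>) (carrier (continuous_functions T))"
proof (rule inj_onI)
  fix f g
  assume f: "f \<in> carrier (continuous_functions T)" and g: "g \<in> carrier (continuous_functions T)"
    and eq: "pullback (topspace T) \<phi> f = pullback (topspace T) \<phi> g"
  have "f (\<phi> s) = g (\<phi> s)" if "s \<in> topspace T" for s
    using fun_cong[OF eq, of s] that by (simp add: pullback_def)
  then have "f t = g t" if "t \<in> topspace T" for t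
    using \<phi> that by (metis imageE)
  then show "f = g"
    using f g continuous_functions_extensional extensionalityI by metis
qed

section \<open>Averaging over the fibres of a finite-to-one map\<close>

definition fibre :: "'g set \<Rightarrow> ('g \<Rightarrow> 'g) \<Rightarrow> 'g \<Rightarrow> 'g set" where
  "fibre X \<phi> t = {s \<in> X. \<phi> s = t}"

definition fibre_average ::
    "'g set \<Rightarrow> ('g \<Rightarrow> 'g) \<Rightarrow> ('g \<Rightarrow> complex) \<Rightarrow> ('g \<Rightarrow> complex)" where
  "fibre_average X \<phi> f =
     (\<lambda>t\<in>X. 1 / of_nat (card (fibre X \<phi> t)) * (\<Sum>s\<in>fibre X \<phi> t. f s))"

lemma cmod_fibre_average_le:
  assumes "t \<in> X" "0 \<le> B" and "\<And>s. s \<in> X \<Longrightarrow> cmod (f s) \<le> B"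
  shows "cmod (fibre_average X \<phi> f t) \<le> B"
proof -
  have "cmod (\<Sum>s\<in>fibre X \<phi> t. f s) \<le> of_nat (card (fibre X \<phi> t)) * B"
    using assms(3) by (intro sum_norm_bound) (auto simp: fibre_def)
  \<comment> \<open>If the fibre is empty or infinite, the average takes the default value 0.\<close>
  with assms(1,2) show ?thesis
    by (cases "card (fibre X \<phi> t) = 0")
      (auto simp: fibre_average_def norm_mult norm_divide field_simps)
qed

text \<open>
  Continuity of the averages is a hypothesis because it may fail for a general continuous map, where
  the number of points in a fibre may jump. Once it is granted, everything else holds fibre by
  fibre, and continuity of the operator itself follows because it is a contraction.
\<close>

lemma transfer_operator_fibre_average:
  assumes T: "compact_space T" "topspace T \<noteq> {}" and \<phi>: "continuous_map T T \<phi>"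
    and closed: "\<And>f. f \<in> carrier (continuous_functions T) \<Longrightarrow>
      fibre_average (topspace T) \<phi> f \<in> carrier (continuous_functions T)"
  shows "transfer_operator (continuous_functions T)
    (pullback (topspace T) \<phi>) (fibre_average (topspace T) \<phi>)"
proof -
  let ?A = "continuous_functions T" and ?L = "fibre_average (topspace T) \<phi>"
  interpret Metric_space "carrier ?A" "cdist ?A" by (rule Metric_space_cdist[OF T])
  have contraction: "cdist ?A (?L f) (?L g) \<le> cdist ?A f g"
    if f: "f \<in> carrier ?A" and g: "g \<in> carrier ?A" for f g
  proof -
    let ?h = "\<lambda>s\<in>topspace T. f s - g s"
    have h: "?h \<in> carrier ?A"
      using f g by (rule continuous_functions_closed)
    have Lh: "?L ?h t = ?L f t - ?L g t" if "t \<in> topspace T" for t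
      using that
      by (auto simp: fibre_average_def fibre_def sum_subtractf algebra_simps)
    have dist: "cdist ?A f g = cnorm ?A ?h"
      using f g by (simp add: cdist_def continuous_functions_minus)
    have "cdist ?A (?L f) (?L g) = cnorm ?A (\<lambda>t\<in>topspace T. ?L f t - ?L g t)"
      using closed[OF f] closed[OF g] by (simp add: cdist_def continuous_functions_minus)
    also have "\<dots> \<le> cdist ?A f g"
    proof (rule cnorm_le[OF T(2)])
      fix t assume t: "t \<in> topspace T"
      have "cmod (?L ?h t) \<le> cdist ?A f g"
        by (rule cmod_fibre_average_le[OF t nonneg cmod_le_cnorm[OF T(1) h, folded dist]])
      with t show "cmod ((\<lambda>t\<in>topspace T. ?L f t - ?L g t) t) \<le> cdist ?A f g"
        by (simp add: Lh)
    qed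
    finally show ?thesis .
  qed
  show ?thesis
  proof (intro transfer_operator.intro transfer_operator_axioms.intro
      cstar_endomorphism_pullback T \<phi>)
    show "?L \<in> carrier ?A \<rightarrow> carrier ?A"
      using closed by blast
    show "continuous_map mtopology mtopology ?L"
      unfolding metric_continuous_map[OF Metric_space_axioms]
      using closed contraction by (meson image_subsetI le_less_trans)
    fix f assume f: "f \<in> carrier ?A"
    show "?L (c \<odot>\<^bsub>?A\<^esub> f) = c \<odot>\<^bsub>?A\<^esub> ?L f" for c
      by (auto simp: fibre_average_def fibre_def sum_distrib_left sum_divide_distrib
          intro!: restrict_ext sum.cong)
    fix g assume g: "g \<in> carrier ?A"
    show "?L (f \<oplus>\<^bsub>?A\<^esub> g) = ?L f \<oplus>\<^bsub>?A\<^esub> ?L g"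
      by (auto simp: fibre_average_def fibre_def sum.distrib algebra_simps intro!: restrict_ext)
    show "?L (pullback (topspace T) \<phi> f \<otimes>\<^bsub>?A\<^esub> g) = f \<otimes>\<^bsub>?A\<^esub> ?L g"
      by (auto simp: fibre_average_def fibre_def pullback_def sum_distrib_left sum_divide_distrib
          intro!: restrict_ext sum.cong)
  next
    fix f assume "f \<in> positive_elements ?A"
    then have f: "f \<in> carrier ?A" and nonneg: "\<And>s. s \<in> topspace T \<Longrightarrow> f s \<in> \<real>\<^sub>\<ge>\<^sub>0"
      by (auto simp: positive_elements_continuous_functions_iff)
    have "(\<Sum>s\<in>fibre (topspace T) \<phi> t. f s) \<in> \<real>\<^sub>\<ge>\<^sub>0" for t
      using nonneg by (auto simp: complex_nonneg_Reals_iff fibre_def Re_sum Im_sum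
          intro!: sum_nonneg sum.neutral)
    then show "?L f \<in> positive_elements ?A"
      using closed[OF f]
      by (auto simp: positive_elements_continuous_functions_iff fibre_average_def)
  qed
qed

text \<open>
  The inner fibres need a common size \<open>k\<close>: otherwise the mean of the means would weight the points
  of the big fibre unequally.
\<close>

lemma fibre_average_fibre_average:
  assumes \<psi>: "\<psi> \<in> X \<rightarrow> X"
    and finite: "\<And>t. t \<in> X \<Longrightarrow> finite (fibre X \<phi> t)" "\<And>t. t \<in> X \<Longrightarrow> finite (fibre X \<psi> t)"
    and card: "\<And>t. t \<in> X \<Longrightarrow> card (fibre X \<psi> t) = k"
  shows "fibre_average X \<phi> (fibre_average X \<psi> f) = fibre_average X (\<lambda>s. \<phi> (\<psi> s)) f"
proof -
  have "fibre_average X \<phi> (fibre_average X \<psi> f) t = fibre_average X (\<lambda>s. \<phi> (\<psi> s)) f t"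
    if t: "t \<in> X" for t
  proof -
    have sub: "r \<in> X" if "r \<in> fibre X \<phi> t" for r
      using that by (simp add: fibre_def)
    have Un: "fibre X (\<lambda>s. \<phi> (\<psi> s)) t = (\<Union>r\<in>fibre X \<phi> t. fibre X \<psi> r)"
      using \<psi> by (auto simp: fibre_def)
    have disj: "\<forall>r\<in>fibre X \<phi> t. \<forall>r'\<in>fibre X \<phi> t. r \<noteq> r' \<longrightarrow> fibre X \<psi> r \<inter> fibre X \<psi> r' = {}"
      by (auto simp: fibre_def)
    have "card (fibre X (\<lambda>s. \<phi> (\<psi> s)) t) = (\<Sum>r\<in>fibre X \<phi> t. card (fibre X \<psi> r))"
      unfolding Un using finite t sub disj by (intro card_UN_disjoint) auto
    also have "\<dots> = card (fibre X \<phi> t) * k"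
      using card sub by simp
    finally have c: "card (fibre X (\<lambda>s. \<phi> (\<psi> s)) t) = card (fibre X \<phi> t) * k" .
    have "(\<Sum>s\<in>fibre X (\<lambda>s. \<phi> (\<psi> s)) t. f s) = (\<Sum>r\<in>fibre X \<phi> t. \<Sum>s\<in>fibre X \<psi> r. f s)"
      unfolding Un using finite t sub disj by (intro sum.UNION_disjoint) auto
    moreover have "(\<Sum>r\<in>fibre X \<phi> t. fibre_average X \<psi> f r)
        = 1 / of_nat k * (\<Sum>r\<in>fibre X \<phi> t. \<Sum>s\<in>fibre X \<psi> r. f s)"
      unfolding sum_distrib_left using sub card
      by (intro sum.cong) (simp_all add: fibre_average_def sum_divide_distrib)
    ultimately show ?thesis
      using t c by (simp add: fibre_average_def[of X \<phi>] fibre_average_def[of X "\<lambda>s. \<phi> (\<psi> s)"])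
  qed
  then show ?thesis
    by (intro ext) (metis fibre_average_def restrict_apply)
qed

section \<open>Fibres of a group endomorphism\<close>

lemma (in group) bij_betw_kernel_fibre:
  assumes \<phi>: "\<phi> \<in> hom G G" and s: "s \<in> carrier G"
  shows "bij_betw (\<lambda>k. k \<otimes> s) (kernel G G \<phi>) (fibre (carrier G) \<phi> (\<phi> s))"
proof -
  interpret group_hom G G \<phi>
    by (simp add: group_hom.intro group_hom_axioms.intro is_group \<phi>)
  show ?thesis
  proof (rule bij_betwI[where g = "\<lambda>r. r \<otimes> inv s"])
    show "(\<lambda>k. k \<otimes> s) \<in> kernel G G \<phi> \<rightarrow> fibre (carrier G) \<phi> (\<phi> s)"
      using s by (auto simp: kernel_def fibre_def)
    show "(\<lambda>r. r \<otimes> inv s) \<in> fibre (carrier G) \<phi> (\<phi> s) \<rightarrow> kernel G G \<phi>"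
      using s by (auto simp: kernel_def fibre_def)
  qed (use s in \<open>auto simp: kernel_def fibre_def m_assoc\<close>)
qed

lemma (in group) fibre_surjective_hom:
  assumes "\<phi> \<in> hom G G" and "\<phi> ` carrier G = carrier G" and "finite (kernel G G \<phi>)"
    and "t \<in> carrier G"
  shows finite_fibre_surjective_hom: "finite (fibre (carrier G) \<phi> t)"
    and card_fibre_surjective_hom: "card (fibre (carrier G) \<phi> t) = card (kernel G G \<phi>)"
proof -
  obtain s where "s \<in> carrier G" "t = \<phi> s"
    using assms(2,4) by auto
  with bij_betw_kernel_fibre[OF assms(1), of s] assms(3)
  show "finite (fibre (carrier G) \<phi> t)"
    and "card (fibre (carrier G) \<phi> t) = card (kernel G G \<phi>)"
    by (auto dest: bij_betw_finite bij_betw_same_card)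
qed

text \<open>
  The average composed with \<open>\<phi>\<close> is a mean over translates by the finite kernel, so it is
  continuous; continuity then descends along \<open>\<phi>\<close>, which is a quotient map by compactness.
\<close>

lemma (in compact_abelian_group) fibre_average_closed:
  assumes "surjective_endomorphism_finite_kernel G T \<phi>"
    and f: "f \<in> carrier (continuous_functions T)"
  shows "fibre_average (topspace T) \<phi> f \<in> carrier (continuous_functions T)"
proof -
  let ?K = "kernel G G \<phi>" and ?L = "fibre_average (carrier G) \<phi> f"
  from assms(1) have hom: "\<phi> \<in> hom G G" and cont: "continuous_map T T \<phi>"
    and surj: "\<phi> ` carrier G = carrier G" and fin: "finite ?K"
    by (auto simp: surjective_endomorphism_finite_kernel_def)
  have "continuous_map T T (\<lambda>s. k \<otimes> s)" if "k \<in> ?K" for k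
  proof -
    have "continuous_map T (prod_topology T T) (\<lambda>s. (k, s))"
      using that by (intro continuous_map_pairedI) (auto simp: kernel_def topspace_eq)
    from continuous_map_compose[OF this continuous_mult] show ?thesis
      by (simp add: comp_def)
  qed
  then have "continuous_map T euclidean (\<lambda>s. f (k \<otimes> s))" if "k \<in> ?K" for k
    using continuous_map_compose[OF _ continuous_functions_continuous[OF f], of T "\<lambda>s. k \<otimes> s"] that
    by (simp add: comp_def)
  then have "continuous_map T euclidean (\<lambda>s. 1 / of_nat (card ?K) * (\<Sum>k\<in>?K. f (k \<otimes> s)))"
    using fin by (intro continuous_intros) auto
  moreover have "1 / of_nat (card ?K) * (\<Sum>k\<in>?K. f (k \<otimes> s)) = (?L \<circ> \<phi>) s"
    if "s \<in> topspace T" for s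
  proof -
    have s: "s \<in> carrier G" "\<phi> s \<in> carrier G"
      using that surj by (auto simp: topspace_eq)
    then show ?thesis
      using sum.reindex_bij_betw[OF bij_betw_kernel_fibre[OF hom s(1)], of f]
      by (simp add: fibre_average_def card_fibre_surjective_hom[OF hom surj fin])
  qed
  ultimately have "continuous_map T euclidean (?L \<circ> \<phi>)"
    by (rule continuous_map_eq)
  moreover have "quotient_map T T \<phi>"
    using cont surj by (intro T1_Spaces.continuous_imp_quotient_map compact Hausdorff)
      (simp_all add: topspace_eq)
  ultimately have "continuous_map T euclidean ?L"
    by (rule continuous_compose_quotient_map[rotated])
  then show ?thesis
    by (simp add: in_continuous_functions_iff topspace_eq) (simp add: fibre_average_def)
qed

theorem proposition4p2:
  fixes G :: "('g, 'm) monoid_scheme" and T :: "'g topology"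
  assumes "compact_abelian_group G T"
    and "Nstar_action (carrier G) (power_map G)"
    and "\<forall>n>0. surjective_endomorphism_finite_kernel G T (power_map G n)"
  shows "(\<forall>n>0. cstar_endomorphism (continuous_functions T) (power_pullback G n) \<and>
            power_pullback G n \<one>\<^bsub>continuous_functions T\<^esub> = \<one>\<^bsub>continuous_functions T\<^esub> \<and>
            inj_on (power_pullback G n) (carrier (continuous_functions T))) \<and>
         Nstar_action (carrier (continuous_functions T)) (power_pullback G) \<and>
         transfer_action (continuous_functions T) (power_pullback G) (power_average G)"
proof -
  interpret compact_abelian_group G T by fact
  let ?A = "continuous_functions T" and ?X = "carrier G" and ?p = "power_map G"
  have T: "compact_space T" "topspace T \<noteq> {}"
    using compact one_closed by (auto simp: topspace_eq)
  have pullback_eq: "power_pullback G n = pullback ?X (?p n)" for n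
    by (simp add: fun_eq_iff power_pullback_def pullback_def)
  have average_eq: "power_average G n = fibre_average ?X (?p n)" for n
    by (simp add: fun_eq_iff power_average_def fibre_average_def fibre_def)
  have hom: "?p n \<in> hom G G" and cont: "continuous_map T T (?p n)"
    and surj: "?p n ` ?X = ?X" and fin: "finite (kernel G G (?p n))" if "n > 0" for n
    using assms(3) that by (auto simp: surjective_endomorphism_finite_kernel_def)
  have closed: "?p n s \<in> ?X" if "s \<in> ?X" for n s
    using that by (simp add: power_map_def)
  have one: "?p 1 s = s" if "s \<in> ?X" for s
    using assms(2) that by (simp add: Nstar_action_def)
  have comp: "?p m (?p n s) = ?p (m * n) s" if "m > 0" "n > 0" "s \<in> ?X" for m n s
    using assms(2) that by (simp add: Nstar_action_def)
  have endo: "cstar_endomorphism ?A (power_pullback G n)" if "n > 0" for n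
    using cstar_endomorphism_pullback[OF T cont[OF that]] by (simp add: pullback_eq topspace_eq)
  have unital: "power_pullback G n \<one>\<^bsub>?A\<^esub> = \<one>\<^bsub>?A\<^esub>" for n
    using closed by (auto simp: power_pullback_def topspace_eq)
  have inj: "inj_on (power_pullback G n) (carrier ?A)" if "n > 0" for n
    using inj_on_pullback[of "?p n" T] surj[OF that] by (simp add: pullback_eq topspace_eq)
  have pullback_action: "Nstar_action (carrier ?A) (power_pullback G)"
    unfolding Nstar_action_def
  proof (intro conjI allI impI ballI)
    fix n :: nat assume n: "n > 0"
    show "power_pullback G n \<in> carrier ?A \<rightarrow> carrier ?A"
      by (rule cstar_endomorphism.endo_closed[OF endo[OF n]])
    fix m :: nat and f assume m: "m > 0"
    show "power_pullback G n (power_pullback G m f) = power_pullback G (n * m) f"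
      using m n closed comp[OF m n] by (auto simp: power_pullback_def mult.commute)
  next
    fix f assume "f \<in> carrier ?A"
    then have "restrict f ?X = f"
      using continuous_functions_extensional extensional_restrict by (metis topspace_eq)
    then show "power_pullback G 1 f = f"
      unfolding power_pullback_def using one by (metis restrict_ext)
  qed
  have transfer: "transfer_operator ?A (power_pullback G n) (power_average G n)" if "n > 0" for n
    using transfer_operator_fibre_average[OF T cont[OF that] fibre_average_closed] assms(3) that
    by (simp add: pullback_eq average_eq topspace_eq)
  have average_action: "Nstar_action (carrier ?A) (power_average G)"
    unfolding Nstar_action_def
  proof (intro conjI allI impI ballI)
    fix n :: nat assume n: "n > 0"
    show "power_average G n \<in> carrier ?A \<rightarrow> carrier ?A"
      by (rule transfer_operator.transfer_closed[OF transfer[OF n]])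
    fix m :: nat and f assume m: "m > 0"
    have "fibre_average ?X (?p n) (fibre_average ?X (?p m) f)
        = fibre_average ?X (\<lambda>s. ?p n (?p m s)) f"
      using closed finite_fibre_surjective_hom card_fibre_surjective_hom hom surj fin m n
      by (intro fibre_average_fibre_average) auto
    also have "\<dots> = fibre_average ?X (?p (n * m)) f"
      using comp[OF n m] by (simp add: fibre_average_def fibre_def cong: conj_cong)
    finally show "power_average G n (power_average G m f) = power_average G (n * m) f"
      by (simp add: average_eq)
  next
    fix f assume f: "f \<in> carrier ?A"
    have "fibre ?X (?p 1) t = {t}" if "t \<in> ?X" for t
      using one that by (auto simp: fibre_def)
    then have "power_average G 1 f = restrict f ?X"
      by (auto simp: average_eq fibre_average_def)
    then show "power_average G 1 f = f"
      using continuous_functions_extensional[OF f] by (simp add: topspace_eq extensional_restrict)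
  qed
  show ?thesis
    using endo unital inj pullback_action transfer average_action
    by (simp add: transfer_action_def)
qed

end
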